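(* Let $(\mathbb{X},d)$ be a complete metric space with $|\mathbb{X}|\geq 3$ and let $T:\mathbb{X}\to\mathbb{X}$ be a weak contraction map on the perimeters of triangles in $\mathbb{X}$. Suppose that $T^2x\neq x$ for all $x\in\mathbb{X}$ with $Tx\neq x$. Then for every $x_0\in\mathbb{X}$ the sequence $(T^nx_0)_{n\geq 0}$ converges to some $x^*\in\mathbb{X}$, and $x^*$ is a fixed point of $T$. Moreover, if $x^*\neq T^nx_0$ for every $n\in\mathbb{N}\cup\{0\}$, then $x^*$ is the unique fixed point of $T$.
   Context: Let $(\mathbb{X},d)$ be a metric space with at least three points. A mapping $T:\mathbb{X}\to\mathbb{X}$ is called a weak contraction map on the perimeters of triangles in $\mathbb{X}$ if there exists $k\in(0,1)$ such that for every three pairwise distinct points $x,y,z\in\mathbb{X}$, $$d(Tx,Ty)+d(Ty,Tz)+d(Tz,Tx)\leq k\max\big\{d(x',y')+d(y',z')+d(z',x') : x',y',z'\in\{x,y,z,Tx,Ty,Tz\},\ x',y',z'\text{ pairwise distinct}\big\}.$$ *)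

theory Defs
  imports "HOL-Analysis.Analysis"
begin

definition perimeter :: "'a::metric_space \<Rightarrow> 'a \<Rightarrow> 'a \<Rightarrow> real" where
  "perimeter x y z = dist x y + dist y z + dist z x"

definition pairwise_distinct3 :: "'a \<Rightarrow> 'a \<Rightarrow> 'a \<Rightarrow> bool" where
  "pairwise_distinct3 x y z \<longleftrightarrow> x \<noteq> y \<and> y \<noteq> z \<and> z \<noteq> x"

definition triangle_perimeters :: "'a::metric_space set \<Rightarrow> real set" where
  "triangle_perimeters S =
     {perimeter x y z | x y z. x \<in> S \<and> y \<in> S \<and> z \<in> S \<and> pairwise_distinct3 x y z}"

definition weak_perimeter_contraction :: "('a::metric_space \<Rightarrow> 'a) \<Rightarrow> bool" where
  "weak_perimeter_contraction T \<longleftrightarrow>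
     (\<exists>k::real. 0 < k \<and> k < 1 \<and>
       (\<forall>x y z. pairwise_distinct3 x y z \<longrightarrow>
          perimeter (T x) (T y) (T z)
            \<le> k * Max (triangle_perimeters {x, y, z, T x, T y, T z})))"

text \<open>The argument of \<^const>\<open>Max\<close> above is finite and nonempty, so the maximum is a genuine one.\<close>

lemma finite_triangle_perimeters:
  assumes "finite S"
  shows "finite (triangle_perimeters S)"
proof -
  have "triangle_perimeters S \<subseteq> (\<lambda>(x, y, z). perimeter x y z) ` (S \<times> S \<times> S)"
    unfolding triangle_perimeters_def by force
  then show ?thesis
    using assms by (meson finite_SigmaI finite_imageI finite_subset)
qed

lemma triangle_perimeters_nonempty:
  assumes "pairwise_distinct3 x y z"
  shows "triangle_perimeters {x, y, z, T x, T y, T z} \<noteq> {}"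
  using assms unfolding triangle_perimeters_def by blast

end

theory Submission
  imports Defs
begin

text \<open>
  An orbit that never meets a fixed point has three pairwise distinct points among any three
  consecutive ones. On such an orbit the perimeters of triples of index at least \<open>m + 1\<close> are at
  most \<open>k\<close> times the largest perimeter of triples of index at least \<open>m\<close>, as for Ciric's
  quasi-contractions: a degenerate triple is dominated by a genuine triangle of the orbit. Moving
  the initial point to its image then bounds all perimeters, and iterating makes them decay
  geometrically, so that the orbit is Cauchy. Both the fixed point property and uniqueness follow
  by applying the contraction to triangles that collapse onto a segment from \<open>a\<close> to \<open>b\<close>, with
  images collapsing onto the same segment; in the limit \<open>2 dist a b \<le> k (2 dist a b)\<close>.
\<close>

lemma two_dist_le_perimeter: "2 * dist x y \<le> perimeter x y z"
  using dist_triangle[of x y z] by (simp add: perimeter_def dist_commute)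

text \<open>Each of the three sides changes by at most \<open>e\<close> per endpoint.\<close>

lemma perimeter_perturb:
  assumes "dist u u' \<le> e" "dist v v' \<le> e" "dist w w' \<le> e"
  shows "perimeter u v w \<le> perimeter u' v' w' + 6 * e"
proof -
  have quad: "dist p q \<le> dist p' q' + 2 * e" if "dist p p' \<le> e" "dist q q' \<le> e" for p q p' q' :: 'a
    using that dist_triangle[of p q p'] dist_triangle[of p' q q'] by (simp add: dist_commute)
  show ?thesis
    using quad[OF assms(1,2)] quad[OF assms(2,3)] quad[OF assms(3,1)]
    by (simp add: perimeter_def)
qed

text \<open>The maximum over genuine triangles is replaced by any bound \<open>B\<close> on the
  perimeters of all triples, degenerate ones included, from any superset \<open>S\<close> of the six
  points. Estimates can then use index windows or balls for \<open>S\<close>.\<close>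

locale perimeter_contraction =
  fixes T :: "'a::metric_space \<Rightarrow> 'a" and k :: real
  assumes k: "0 < k" "k < 1"
    and contr: "\<And>x y z S B. pairwise_distinct3 x y z \<Longrightarrow> {x, y, z, T x, T y, T z} \<subseteq> S
      \<Longrightarrow> (\<And>u v w. u \<in> S \<Longrightarrow> v \<in> S \<Longrightarrow> w \<in> S \<Longrightarrow> perimeter u v w \<le> B)
      \<Longrightarrow> perimeter (T x) (T y) (T z) \<le> k * B"

text \<open>Injectivity of \<open>f\<close> is not assumed: \<open>distinct\<close> concerns
  consecutive terms only, which is what the absence of fixed points and 2-cycles provides.\<close>

locale perimeter_contraction_orbit = perimeter_contraction T k
  for T :: "'a::metric_space \<Rightarrow> 'a" and k :: real +
  fixes f :: "nat \<Rightarrow> 'a"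
  assumes orbit: "f (Suc n) = T (f n)"
    and distinct: "pairwise_distinct3 (f n) (f (Suc n)) (f (Suc (Suc n)))"

lemma weak_perimeter_contractionE:
  assumes "weak_perimeter_contraction T"
  obtains k where "perimeter_contraction T k"
proof -
  obtain k where k: "0 < k" "k < 1"
    and contr: "\<And>x y z. pairwise_distinct3 x y z \<Longrightarrow>
      perimeter (T x) (T y) (T z) \<le> k * Max (triangle_perimeters {x, y, z, T x, T y, T z})"
    using assms unfolding weak_perimeter_contraction_def by blast
  have "perimeter_contraction T k"
  proof (rule perimeter_contraction.intro[OF k])
    fix x y z S B
    assume distinct: "pairwise_distinct3 x y z"
      and sub: "{x, y, z, T x, T y, T z} \<subseteq> S"
      and bound: "\<And>u v w. u \<in> S \<Longrightarrow> v \<in> S \<Longrightarrow> w \<in> S \<Longrightarrow> perimeter u v w \<le> B"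
    let ?P = "triangle_perimeters {x, y, z, T x, T y, T z}"
    have "r \<le> B" if r: "r \<in> ?P" for r
    proof -
      obtain u v w where "r = perimeter u v w"
        "u \<in> {x, y, z, T x, T y, T z}" "v \<in> {x, y, z, T x, T y, T z}" "w \<in> {x, y, z, T x, T y, T z}"
        using r unfolding triangle_perimeters_def by blast
      then show ?thesis
        using bound sub by (metis subsetD)
    qed
    moreover have "finite ?P"
      by (intro finite_triangle_perimeters) simp
    moreover have "?P \<noteq> {}"
      using distinct by (rule triangle_perimeters_nonempty)
    ultimately have "Max ?P \<le> B"
      by simp
    then show "perimeter (T x) (T y) (T z) \<le> k * B"
      using contr[OF distinct] k mult_left_mono[of "Max ?P" B k] by linarith
  qed
  then show thesis by (rule that)
qed

text \<open>A genuine triangle with indices above \<open>m\<close> is the image of the triangle with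
  indices lowered by one, whose vertices are distinct because their images are. The bound
  \<open>m + 3 \<le> N\<close> leaves room for three consecutive points beyond
  \<open>f m\<close>.\<close>

lemma (in perimeter_contraction_orbit) perimeter_shrink:
  assumes N: "m + 3 \<le> N"
    and bound: "\<And>i j l. i \<in> {m..N} \<Longrightarrow> j \<in> {m..N} \<Longrightarrow> l \<in> {m..N}
      \<Longrightarrow> perimeter (f i) (f j) (f l) \<le> B"
    and ijl: "i \<in> {Suc m..N}" "j \<in> {Suc m..N}" "l \<in> {Suc m..N}"
  shows "perimeter (f i) (f j) (f l) \<le> k * B"
proof -
  have genuine: "perimeter (f i) (f j) (f l) \<le> k * B"
    if dist3: "pairwise_distinct3 (f i) (f j) (f l)"
      and ijl: "i \<in> {Suc m..N}" "j \<in> {Suc m..N}" "l \<in> {Suc m..N}" for i j l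
  proof -
    obtain i' j' l' where eq: "i = Suc i'" "j = Suc j'" "l = Suc l'"
      using ijl by (metis Suc_le_D atLeastAtMost_iff)
    have "perimeter (T (f i')) (T (f j')) (T (f l')) \<le> k * B"
    proof (rule contr[where S = "f ` {m..N}"])
      show "pairwise_distinct3 (f i') (f j') (f l')"
        using dist3 by (auto simp: eq orbit pairwise_distinct3_def)
      have "f p \<in> f ` {m..N} \<and> T (f p) \<in> f ` {m..N}" if "Suc p \<in> {Suc m..N}" for p
        using that by (auto simp flip: orbit)
      then show "{f i', f j', f l', T (f i'), T (f j'), T (f l')} \<subseteq> f ` {m..N}"
        using ijl unfolding eq by blast
    qed (use bound in blast)
    then show ?thesis by (simp add: eq orbit)
  qed
  have pair: "2 * dist (f p) (f q) \<le> k * B" if "p \<in> {Suc m..N}" "q \<in> {Suc m..N}" for p q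
  proof (cases "f p = f q")
    case True
    have "0 \<le> B"
      using bound[of m m m] N by (simp add: perimeter_def)
    then show ?thesis using True k by simp
  next
    case False
    \<comment> \<open>Of three distinct points at most two can be \<open>f p\<close> or
      \<open>f q\<close>; the remaining one completes the segment to a genuine triangle.\<close>
    have "\<exists>r \<in> {Suc m, Suc (Suc m), Suc (Suc (Suc m))}. f r \<noteq> f p \<and> f r \<noteq> f q"
      using distinct[of "Suc m"] unfolding pairwise_distinct3_def by (simp, metis)
    then obtain r where r: "r \<in> {Suc m..N}" "f r \<noteq> f p" "f r \<noteq> f q"
      using N that[of "Suc m"] that[of "Suc (Suc m)"] that[of "Suc (Suc (Suc m))"] by auto
    have "perimeter (f p) (f q) (f r) \<le> k * B"
      using genuine[of p q r] False r that by (simp add: pairwise_distinct3_def)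
    then show ?thesis
      using two_dist_le_perimeter[of "f p" "f q" "f r"] by linarith
  qed
  show ?thesis
  proof (cases "pairwise_distinct3 (f i) (f j) (f l)")
    case True
    then show ?thesis using genuine ijl by blast
  next
    \<comment> \<open>A degenerate perimeter is twice the length of one side.\<close>
    case False
    then show ?thesis
      using pair[of i j] pair[of j l] pair[of l i] ijl
      by (auto simp: pairwise_distinct3_def perimeter_def dist_commute)
  qed
qed

lemma (in perimeter_contraction_orbit) Cauchy_orbit:
  "Cauchy f"
proof -
  \<comment> \<open>The solution of \<open>M = k * M + 6 * dist (f 0) (f 1)\<close>, hence
    independent of the window length \<open>N\<close> below.\<close>
  define M where "M = 6 * dist (f 0) (f 1) / (1 - k)"
  have bounded: "perimeter (f i) (f j) (f l) \<le> M"
    if ijl: "i \<le> N" "j \<le> N" "l \<le> N" and N: "3 \<le> N" for i j l N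
  proof -
    define P where "P = (\<lambda>(i, j, l). perimeter (f i) (f j) (f l)) ` ({0..N} \<times> {0..N} \<times> {0..N})"
    have P: "finite P" "P \<noteq> {}"
      by (auto simp: P_def)
    have le: "perimeter (f i) (f j) (f l) \<le> Max P"
      if "i \<in> {0..N}" "j \<in> {0..N}" "l \<in> {0..N}" for i j l
    proof (rule Max_ge[OF P(1)])
      show "perimeter (f i) (f j) (f l) \<in> P"
        unfolding P_def by (rule image_eqI[of _ _ "(i, j, l)"]) (use that in auto)
    qed
    \<comment> \<open>Index 0 is replaced by 1 and all others are kept, so every triple moves into
      the range of \<open>perimeter_shrink\<close> for \<open>m = 0\<close>.\<close>
    have shift: "dist (f p) (f (max 1 p)) \<le> dist (f 0) (f 1)" for p
      by (cases p) auto
    have "r \<le> k * Max P + 6 * dist (f 0) (f 1)" if rP: "r \<in> P" for r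
    proof -
      obtain i j l where r: "r = perimeter (f i) (f j) (f l)" "i \<le> N" "j \<le> N" "l \<le> N"
        using rP by (auto simp: P_def)
      have "perimeter (f (max 1 i)) (f (max 1 j)) (f (max 1 l)) \<le> k * Max P"
        by (rule perimeter_shrink[where m = 0 and N = N])
          (use r N le in auto)
      then show ?thesis
        using perimeter_perturb[OF shift shift shift, of i j l] r(1) by simp
    qed
    then have "Max P \<le> k * Max P + 6 * dist (f 0) (f 1)"
      using P by simp
    then have "Max P \<le> M"
      using k by (simp add: M_def field_simps)
    then show ?thesis
      using le[of i j l] ijl by simp
  qed
  have decay: "perimeter (f i) (f j) (f l) \<le> k ^ m * M"
    if "i \<in> {m..N}" "j \<in> {m..N}" "l \<in> {m..N}" "m + 3 \<le> N" for i j l m N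
    using that
  proof (induction m arbitrary: i j l)
    case 0
    then show ?case using bounded[of i N j l] by simp
  next
    case (Suc m)
    have "perimeter (f i) (f j) (f l) \<le> k * (k ^ m * M)"
      by (rule perimeter_shrink[where m = m and N = N])
        (use Suc in auto)
    then show ?case by (simp add: mult.assoc)
  qed
  show ?thesis
  proof (rule metric_CauchyI)
    fix e :: real
    assume "0 < e"
    have "(\<lambda>n. k ^ n * M) \<longlonglongrightarrow> 0"
      using k by (intro tendsto_mult_left_zero LIMSEQ_power_zero) simp
    then obtain n where n: "k ^ n * M < e"
      using \<open>0 < e\<close> by (metis order_tendstoD(2) eventually_sequentially order_refl)
    \<comment> \<open>The degenerate triple \<open>p\<close>, \<open>q\<close>, \<open>q\<close>
      suffices; the window end only has to exceed both indices and \<open>n + 3\<close>.\<close>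
    have "dist (f p) (f q) < e" if "p \<ge> n" "q \<ge> n" for p q
      using decay[of p n "p + q + n + 3" q q] two_dist_le_perimeter[of "f p" "f q" "f q"] that n
      by simp (smt (verit) zero_le_dist)
    then show "\<exists>n. \<forall>p\<ge>n. \<forall>q\<ge>n. dist (f p) (f q) < e" by blast
  qed
qed

text \<open>Among three vertices chosen from \<open>a\<close> and \<open>b\<close> two coincide, so
  perimeters within the two balls are at most \<open>2 * dist a b + 6 * e\<close>. The image
  triangle lies near \<open>a\<close>, \<open>a\<close>, \<open>b\<close>, so its perimeter is at
  least \<open>2 * dist a b - 6 * e\<close>. Letting \<open>e\<close> tend to 0 forces
  \<open>dist a b = 0\<close> since \<open>k < 1\<close>.\<close>

lemma (in perimeter_contraction) collapsing_triangles_eq: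
  assumes collapse: "\<And>e. 0 < e \<Longrightarrow> \<exists>u v w. pairwise_distinct3 u v w \<and>
      {u, v, w} \<subseteq> cball a e \<union> cball b e \<and> T u \<in> cball a e \<and> T v \<in> cball a e \<and> T w \<in> cball b e"
  shows "a = b"
proof -
  have small: "2 * (1 - k) * dist a b \<le> 12 * e" if "0 < e" for e
  proof -
    obtain u v w where distinct: "pairwise_distinct3 u v w"
      and near: "{u, v, w} \<subseteq> cball a e \<union> cball b e"
      and image: "T u \<in> cball a e" "T v \<in> cball a e" "T w \<in> cball b e"
      using collapse[OF \<open>0 < e\<close>] by blast
    have "perimeter (T u) (T v) (T w) \<le> k * (2 * dist a b + 6 * e)"
    proof (rule contr[OF distinct, where S = "cball a e \<union> cball b e"])
      show "{u, v, w, T u, T v, T w} \<subseteq> cball a e \<union> cball b e"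
        using near image by blast
      fix p q r
      assume "p \<in> cball a e \<union> cball b e" "q \<in> cball a e \<union> cball b e" "r \<in> cball a e \<union> cball b e"
      then obtain p' q' r' where "{p', q', r'} \<subseteq> {a, b}"
        "dist p p' \<le> e" "dist q q' \<le> e" "dist r r' \<le> e"
        by (auto simp: dist_commute)
      moreover from this(1) have "perimeter p' q' r' \<le> 2 * dist a b"
        by (auto simp: perimeter_def dist_commute)
      ultimately show "perimeter p q r \<le> 2 * dist a b + 6 * e"
        using perimeter_perturb by fastforce
    qed
    moreover have "2 * dist a b \<le> perimeter (T u) (T v) (T w) + 6 * e"
      using perimeter_perturb[of a "T u" e a "T v" b "T w"] image
      by (simp add: perimeter_def dist_commute)
    moreover have "k * (6 * e) \<le> 6 * e"
      using k \<open>0 < e\<close> by simp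
    ultimately show ?thesis
      by (simp add: algebra_simps)
  qed
  have "2 * (1 - k) * dist a b \<le> 0"
    by (rule field_le_epsilon) (use small[of "_ / 12"] in auto)
  then show ?thesis
    using k by (simp add: mult_le_0_iff)
qed

theorem theorem2p4:
  fixes T :: "'a::complete_space \<Rightarrow> 'a"
  assumes three_points: "\<exists>x y z :: 'a. pairwise_distinct3 x y z"
    and contraction: "weak_perimeter_contraction T"
    and no_2_cycle: "\<And>x. T x \<noteq> x \<Longrightarrow> (T ^^ 2) x \<noteq> x"
  shows "\<forall>x\<^sub>0. \<exists>x'. (\<lambda>n. (T ^^ n) x\<^sub>0) \<longlonglongrightarrow> x' \<and> T x' = x' \<and>
           ((\<forall>n. x' \<noteq> (T ^^ n) x\<^sub>0) \<longrightarrow> (\<forall>y. T y = y \<longrightarrow> y = x'))"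
proof
  fix x\<^sub>0
  define f where "f n = (T ^^ n) x\<^sub>0" for n
  have orbit: "f (Suc n) = T (f n)" for n
    by (simp add: f_def)
  have "\<exists>x'. f \<longlonglongrightarrow> x' \<and> T x' = x' \<and> ((\<forall>n. x' \<noteq> f n) \<longrightarrow> (\<forall>y. T y = y \<longrightarrow> y = x'))"
  proof (cases "\<exists>n. T (f n) = f n")
    case True
    then obtain n where n: "T (f n) = f n" by blast
    have "f m = f n" if "n \<le> m" for m
      using that by (induction rule: dec_induct) (simp_all add: orbit n)
    then have "f \<longlonglongrightarrow> f n"
      by (intro tendsto_eventually eventually_sequentiallyI)
    \<comment> \<open>The limit is itself a point of the orbit, so the uniqueness clause holds
      vacuously.\<close>
    then show ?thesis using n by blast
  next
    case False
    then have moving: "T (f n) \<noteq> f n" for n by blast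
    have distinct: "pairwise_distinct3 (f n) (f (Suc n)) (f (Suc (Suc n)))" for n
      using moving[of n] moving[of "Suc n"] no_2_cycle[OF moving[of n]]
      by (auto simp: pairwise_distinct3_def orbit numeral_2_eq_2)
    obtain k where "perimeter_contraction T k"
      using weak_perimeter_contractionE[OF contraction] .
    then interpret perimeter_contraction_orbit T k f
      using orbit distinct
      by (simp add: perimeter_contraction_orbit_def perimeter_contraction_orbit_axioms_def)
    have "Cauchy f"
      by (rule Cauchy_orbit)
    then obtain a where lim: "f \<longlonglongrightarrow> a"
      by (auto simp: Cauchy_convergent_iff convergent_def)
    have near: "\<exists>i j. f i \<noteq> f j \<and> f i \<noteq> a \<and> f j \<noteq> a \<and>
        {f i, f j, T (f i), T (f j)} \<subseteq> cball a e" if e: "0 < e" for e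
    proof -
      obtain N where N: "\<And>n. N \<le> n \<Longrightarrow> f n \<in> cball a e"
        using metric_LIMSEQ_D[OF lim e] by (auto simp: dist_commute intro: less_imp_le)
      \<comment> \<open>At most one of three consecutive points equals \<open>a\<close>; the other
        two form a genuine triangle with \<open>a\<close>.\<close>
      obtain i j where "N \<le> i" "N \<le> j" "f i \<noteq> f j" "f i \<noteq> a" "f j \<noteq> a"
        using distinct[of N] unfolding pairwise_distinct3_def
        by (metis le_Suc_eq order_refl)
      then show ?thesis
        using N[of i] N[of j] N[of "Suc i"] N[of "Suc j"] by (auto simp: orbit)
    qed
    \<comment> \<open>The triangles \<open>f i\<close>, \<open>f j\<close>, \<open>a\<close> shrink
      to \<open>a\<close>, while their images approach \<open>a\<close>, \<open>a\<close>,
      \<open>T a\<close>.\<close>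
    have "a = T a"
    proof (rule collapsing_triangles_eq)
      fix e :: real
      assume e: "0 < e"
      obtain i j where "f i \<noteq> f j" "f i \<noteq> a" "f j \<noteq> a"
        "{f i, f j, T (f i), T (f j)} \<subseteq> cball a e"
        using near[OF e] by blast
      then show "\<exists>u v w. pairwise_distinct3 u v w \<and>
          {u, v, w} \<subseteq> cball a e \<union> cball (T a) e \<and>
          T u \<in> cball a e \<and> T v \<in> cball a e \<and> T w \<in> cball (T a) e"
        using e by (intro exI[of _ "f i"] exI[of _ "f j"] exI[of _ a])
          (auto simp: pairwise_distinct3_def)
    qed
    \<comment> \<open>Here the triangles are \<open>a\<close>, \<open>f i\<close>, \<open>y\<close>,
      with both \<open>a\<close> and \<open>y\<close> fixed; \<open>f i\<close> differs from
      \<open>y\<close> because no orbit point is fixed.\<close>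
    moreover have "y = a" if y: "T y = y" for y
    proof (rule ccontr)
      assume "y \<noteq> a"
      have "a = y"
      proof (rule collapsing_triangles_eq)
        fix e :: real
        assume e: "0 < e"
        obtain i where "f i \<noteq> a" "{f i, T (f i)} \<subseteq> cball a e"
          using near[OF e] by blast
        moreover have "f i \<noteq> y"
          using moving[of i] y by auto
        ultimately show "\<exists>u v w. pairwise_distinct3 u v w \<and>
            {u, v, w} \<subseteq> cball a e \<union> cball y e \<and>
            T u \<in> cball a e \<and> T v \<in> cball a e \<and> T w \<in> cball y e"
          using e y \<open>y \<noteq> a\<close> \<open>a = T a\<close>
          by (intro exI[of _ a] exI[of _ "f i"] exI[of _ y]) (auto simp: pairwise_distinct3_def)
      qed
      then show False using \<open>y \<noteq> a\<close> by simp
    qed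
    ultimately show ?thesis using lim by metis
  qed
  then show "\<exists>x'. (\<lambda>n. (T ^^ n) x\<^sub>0) \<longlonglongrightarrow> x' \<and> T x' = x' \<and>
           ((\<forall>n. x' \<noteq> (T ^^ n) x\<^sub>0) \<longrightarrow> (\<forall>y. T y = y \<longrightarrow> y = x'))"
    unfolding f_def .
qed

end
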